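(* Let $A$ be a discriminant form and $k\in\frac12\mathbb{Z}$. Let $H_1,\dots,H_m\subset A$ be isotropic subgroups of prime orders $p_i=|H_i|$ with $p_i\neq p_j$ for $i\neq j$. For $S\subset\{1,\dots,m\}$ let $H_S=\sum_{i\in S}H_i$. If $f\in M_{k,A}$ is supported on $H_1^\perp\cup\dots\cup H_m^\perp$, then \[f=\sum_{\emptyset\neq S\subset\{1,\dots,m\}}(-1)^{|S|+1}\frac{1}{|H_S|}\, f\downarrow_{H_S}^A\uparrow_{H_S}^A.\]
   Context: A discriminant form is a finite abelian group $A$ with a non-degenerate quadratic form $Q:A\to\mathbb{Q}/\mathbb{Z}$, bilinear form $(x,y)=Q(x+y)-Q(x)-Q(y)$, signature $\mathrm{sig}(A)\in\mathbb{Z}/8\mathbb{Z}$ defined by $\sum_{\lambda\in A}e(Q(\lambda))=\sqrt{|A|}e(\mathrm{sig}(A)/8)$, $e(z)=e^{2\pi iz}$. $\mathrm{Mp}_2(\mathbb{Z})$ is the metaplectic double cover of $\mathrm{SL}_2(\mathbb{Z})$ (pairs $(M,\phi)$ with $\phi^2=c\tau+d$), generated by $T=(\begin{pmatrix}1&1\\0&1\end{pmatrix},1)$, $S=(\begin{pmatrix}0&-1\\1&0\end{pmatrix},\sqrt\tau)$. The Weil representation $\rho_A$ on $\mathbb{C}[A]$ is $\rho_A(T)\mathfrak{e}_\lambda=e(Q(\lambda))\mathfrak{e}_\lambda$, $\rho_A(S)\mathfrak{e}_\lambda=\frac{e(-\mathrm{sig}(A)/8)}{\sqrt{|A|}}\sum_{\mu}e(-(\lambda,\mu))\mathfrak{e}_\mu$.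 $M_{k,A}$: holomorphic $f:\mathbb{H}\to\mathbb{C}[A]$ with $f(M\tau)=\phi(\tau)^{2k}\rho_A(M,\phi)f(\tau)$, holomorphic at $\infty$; $f=\sum_\mu f_\mu\mathfrak{e}_\mu$; supported on $S$ means $f_\mu=0$ for $\mu\notin S$. For an isotropic subgroup $H$ ($Q|_H=0$), $B=H^\perp/H$ is a discriminant form, $f\downarrow_H^A=\sum_{\mu\in H^\perp}f_\mu\mathfrak{e}_{\mu+H}\in M_{k,B}$ for $f\in M_{k,A}$, and $g\uparrow_H^A=\sum_{\mu\in H^\perp}g_{\mu+H}\mathfrak{e}_\mu\in M_{k,A}$ for $g\in M_{k,B}$. (Each $H_S$ is isotropic.) *)

theory Defs
  imports "HOL-Analysis.Analysis" "HOL-Algebra.Bij" "HOL-Algebra.Coset"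
    "HOL-Algebra.FiniteProduct"
    "HOL-Computational_Algebra.Primes"
begin

section \<open>The group \<open>\<rat>/\<int>\<close> and the character \<open>e\<close>\<close>

quotient_type rat_mod_int = rat / "\<lambda>x y :: rat. x - y \<in> \<int>"
proof (rule equivpI)
  show "reflp (\<lambda>x y :: rat. x - y \<in> \<int>)"
    by (simp add: reflp_def)
  show "symp (\<lambda>x y :: rat. x - y \<in> \<int>)"
    by (rule sympI) (metis Ints_minus minus_diff_eq)
  show "transp (\<lambda>x y :: rat. x - y \<in> \<int>)"
    by (rule transpI) (metis Ints_add diff_add_cancel add_diff_eq)
qed

instantiation rat_mod_int :: ab_group_add
begin

lift_definition zero_rat_mod_int :: rat_mod_int is 0 .

lift_definition plus_rat_mod_int :: "rat_mod_int \<Rightarrow> rat_mod_int \<Rightarrow> rat_mod_int" is "(+)"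
  by (metis Ints_add add_diff_add)

lift_definition uminus_rat_mod_int :: "rat_mod_int \<Rightarrow> rat_mod_int" is uminus
  by (metis Ints_minus minus_diff_minus)

lift_definition minus_rat_mod_int :: "rat_mod_int \<Rightarrow> rat_mod_int \<Rightarrow> rat_mod_int" is "(-)"
proof -
  fix a b c d :: rat
  assume "a - b \<in> \<int>" "c - d \<in> \<int>"
  then have "(a - b) - (c - d) \<in> \<int>" by (rule Ints_diff)
  then show "(a - c) - (b - d) \<in> \<int>" by (simp add: algebra_simps)
qed

instance
  by standard (transfer; simp add: algebra_simps)+

end

lift_definition int_scale :: "int \<Rightarrow> rat_mod_int \<Rightarrow> rat_mod_int" is "\<lambda>n x. of_int n * x"
  by (metis Ints_mult Ints_of_int right_diff_distrib)

definition exp2pi :: "complex \<Rightarrow> complex" where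
  "exp2pi z = exp (2 * of_real pi * \<i> * z)"

lift_definition exp2pi_mod :: "rat_mod_int \<Rightarrow> complex" is "\<lambda>x. exp2pi (of_rat x)"
proof -
  fix x y :: rat
  assume "x - y \<in> \<int>"
  then obtain n where "x = y + of_int n"
    by (metis Ints_cases add.commute diff_add_cancel)
  then have "of_rat x = of_rat y + (of_int n :: complex)"
    by (simp add: of_rat_add)
  moreover have "exp (2 * of_int n * of_real pi * \<i>) = 1"
    by (auto simp: exp_eq_1)
  ultimately show "exp2pi (of_rat x) = exp2pi (of_rat y)"
    by (simp add: exp2pi_def ring_distribs exp_add mult_ac)
qed

section \<open>Discriminant forms\<close>

text \<open>
  The finite abelian group \<open>A\<close> is an abelian group in the sense of HOL-Algebra and is therefore
  written multiplicatively: \<open>x \<otimes>\<^bsub>A\<^esub> y\<close> is the sum of \<open>x\<close> and \<open>y\<close>, and \<open>\<one>\<^bsub>A\<^esub>\<close> is its zero.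
\<close>

definition bilin :: "('a, 'm) monoid_scheme \<Rightarrow> ('a \<Rightarrow> rat_mod_int) \<Rightarrow> 'a \<Rightarrow> 'a \<Rightarrow> rat_mod_int" where
  "bilin A Q x y = Q (x \<otimes>\<^bsub>A\<^esub> y) - Q x - Q y"

locale discriminant_form = comm_group A for A (structure) +
  fixes Q :: "'a \<Rightarrow> rat_mod_int"
  assumes finite_carrier: "finite (carrier A)"
    and quadratic: "\<And>x n. x \<in> carrier A \<Longrightarrow> Q (x [^] (n :: int)) = int_scale (n\<^sup>2) (Q x)"
    and bilinear: "\<And>x y z. x \<in> carrier A \<Longrightarrow> y \<in> carrier A \<Longrightarrow> z \<in> carrier A
      \<Longrightarrow> bilin A Q (x \<otimes> y) z = bilin A Q x z + bilin A Q y z"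
    and nondegenerate: "\<And>x. x \<in> carrier A \<Longrightarrow> (\<forall>y\<in>carrier A. bilin A Q x y = 0) \<Longrightarrow> x = \<one>"

text \<open>
  The class of the signature modulo 8 is represented by its element in \<open>{0..7}\<close>. It is unique
  since these integers give distinct eighth roots of unity, and exists by Milgram's formula.
\<close>

definition sig :: "('a, 'm) monoid_scheme \<Rightarrow> ('a \<Rightarrow> rat_mod_int) \<Rightarrow> int" where
  "sig A Q = (THE s. s \<in> {0..7} \<and>
     (\<Sum>\<mu>\<in>carrier A. exp2pi_mod (Q \<mu>))
       = of_real (sqrt (real (card (carrier A)))) * exp2pi (of_int s / 8))"

definition isotropic :: "('a, 'm) monoid_scheme \<Rightarrow> ('a \<Rightarrow> rat_mod_int) \<Rightarrow> 'a set \<Rightarrow> bool" where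
  "isotropic A Q H \<longleftrightarrow> subgroup H A \<and> (\<forall>x\<in>H. Q x = 0)"

definition perp :: "('a, 'm) monoid_scheme \<Rightarrow> ('a \<Rightarrow> rat_mod_int) \<Rightarrow> 'a set \<Rightarrow> 'a set" where
  "perp A Q H = {x \<in> carrier A. \<forall>h\<in>H. bilin A Q x h = 0}"

definition subgroup_sum :: "('a, 'm) monoid_scheme \<Rightarrow> ('i \<Rightarrow> 'a set) \<Rightarrow> 'i set \<Rightarrow> 'a set" where
  "subgroup_sum A H S = {finprod A h S |h. h \<in> (\<Pi> i\<in>S. H i)}"

section \<open>The metaplectic group\<close>

definition upper_half_plane :: "complex set"  ("\<H>") where
  "\<H> = {\<tau>. Im \<tau> > 0}"

definition moeb :: "int^2^2 \<Rightarrow> complex \<Rightarrow> complex" where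
  "moeb M \<tau> = (of_int (M $ 1 $ 1) * \<tau> + of_int (M $ 1 $ 2)) / (of_int (M $ 2 $ 1) * \<tau> + of_int (M $ 2 $ 2))"

text \<open>
  The second component of an element is a function on \<open>\<H>\<close>; it is made extensional
  (\<open>undefined\<close> off \<open>\<H>\<close>) so that equality of elements is equality on \<open>\<H>\<close>.
\<close>

definition Mp2Z :: "((int^2^2) \<times> (complex \<Rightarrow> complex)) monoid" where
  "Mp2Z = \<lparr>
     carrier = {(M, \<phi>). det M = 1 \<and> \<phi> \<in> extensional \<H> \<and> \<phi> holomorphic_on \<H> \<and>
       (\<forall>\<tau>\<in>\<H>. (\<phi> \<tau>)\<^sup>2 = of_int (M $ 2 $ 1) * \<tau> + of_int (M $ 2 $ 2))},
     monoid.mult = (\<lambda>(M, \<phi>) (N, \<psi>). (M ** N, \<lambda>\<tau>\<in>\<H>. \<phi> (moeb N \<tau>) * \<psi> \<tau>)),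
     one = (mat 1, \<lambda>\<tau>\<in>\<H>. 1)\<rparr>"

definition mp_T :: "(int^2^2) \<times> (complex \<Rightarrow> complex)" where
  "mp_T = (vector [vector [1, 1], vector [0, 1]], \<lambda>\<tau>\<in>\<H>. 1)"

definition mp_S :: "(int^2^2) \<times> (complex \<Rightarrow> complex)" where
  "mp_S = (vector [vector [0, -1], vector [1, 0]], \<lambda>\<tau>\<in>\<H>. csqrt \<tau>)"

section \<open>The Weil representation\<close>

text \<open>The space \<open>\<complex>[A]\<close>: complex functions on \<open>carrier A\<close>, extended by zero.\<close>

definition group_alg :: "('a, 'm) monoid_scheme \<Rightarrow> ('a \<Rightarrow> complex) set" where
  "group_alg A = {v. \<forall>x. x \<notin> carrier A \<longrightarrow> v x = 0}"

definition basis_vec :: "'a \<Rightarrow> 'a \<Rightarrow> complex" where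
  "basis_vec x = (\<lambda>y. if y = x then 1 else 0)"

definition GL_group_alg ::
    "('a, 'm) monoid_scheme \<Rightarrow> (('a \<Rightarrow> complex) \<Rightarrow> ('a \<Rightarrow> complex)) monoid" where
  "GL_group_alg A = BijGroup (group_alg A)
     \<lparr>carrier := {R \<in> Bij (group_alg A). \<forall>u\<in>group_alg A. \<forall>v\<in>group_alg A. \<forall>a b.
        R (\<lambda>x. a * u x + b * v x) = (\<lambda>x. a * R u x + b * R v x)}\<rparr>"

definition weil_representation :: "('a, 'm) monoid_scheme \<Rightarrow> ('a \<Rightarrow> rat_mod_int) \<Rightarrow>
    ((int^2^2) \<times> (complex \<Rightarrow> complex) \<Rightarrow> ('a \<Rightarrow> complex) \<Rightarrow> ('a \<Rightarrow> complex)) \<Rightarrow> bool" where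
  "weil_representation A Q \<rho> \<longleftrightarrow>
     \<rho> \<in> hom Mp2Z (GL_group_alg A) \<and>
     (\<forall>l\<in>carrier A. \<rho> mp_T (basis_vec l) = (\<lambda>x. exp2pi_mod (Q l) * basis_vec l x)) \<and>
     (\<forall>l\<in>carrier A. \<rho> mp_S (basis_vec l) =
        (\<lambda>x. exp2pi (- of_int (sig A Q) / 8) / of_real (sqrt (real (card (carrier A)))) *
          (\<Sum>\<mu>\<in>carrier A. exp2pi_mod (- bilin A Q l \<mu>) * basis_vec \<mu> x)))"

section \<open>Modular forms\<close>

text \<open>Holomorphy at \<open>\<infinity>\<close>: an expansion in non-negative powers of \<open>e(\<tau>/N)\<close> for some \<open>N > 0\<close>.\<close>

definition holomorphic_at_cusp :: "(complex \<Rightarrow> complex) \<Rightarrow> bool" where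
  "holomorphic_at_cusp g \<longleftrightarrow> (\<exists>N > (0 :: nat). \<exists>c :: nat \<Rightarrow> complex.
     \<forall>\<tau>\<in>\<H>. (\<lambda>n. c n * exp2pi (of_nat n * \<tau> / of_nat N)) sums g \<tau>)"

text \<open>
  \<open>M\<^bsub>k,A\<^esub>\<close> for \<open>2 * k \<in> \<int>\<close>; the component \<open>f\<^sub>\<mu>\<close> is \<open>\<lambda>\<tau>. f \<tau> \<mu>\<close>, and the values of \<open>f\<close> off
  \<open>\<H>\<close> are irrelevant. Since \<open>mp_T\<close> and \<open>mp_S\<close> generate \<open>Mp2Z\<close>, the conditions in
  \<^const>\<open>weil_representation\<close> determine \<open>\<rho>\<close> uniquely on \<open>Mp2Z\<close>, and the Weil representation exists
  for every discriminant form; so \<open>\<exists>\<rho>\<close> just names \<open>\<rho>\<^sub>A\<close>.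
\<close>

definition weil_modular_forms :: "('a, 'm) monoid_scheme \<Rightarrow> ('a \<Rightarrow> rat_mod_int) \<Rightarrow> rat \<Rightarrow>
    (complex \<Rightarrow> 'a \<Rightarrow> complex) set" where
  "weil_modular_forms A Q k = {f. \<exists>\<rho>. weil_representation A Q \<rho> \<and>
     (\<forall>\<tau>\<in>\<H>. f \<tau> \<in> group_alg A) \<and>
     (\<forall>\<mu>\<in>carrier A. (\<lambda>\<tau>. f \<tau> \<mu>) holomorphic_on \<H>) \<and>
     (\<forall>(M, \<phi>)\<in>carrier Mp2Z. \<forall>\<tau>\<in>\<H>.
        f (moeb M \<tau>) = (\<lambda>\<mu>. (\<phi> \<tau> powi \<lfloor>2 * k\<rfloor>) * \<rho> (M, \<phi>) (f \<tau>) \<mu>)) \<and>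
     (\<forall>\<mu>\<in>carrier A. holomorphic_at_cusp (\<lambda>\<tau>. f \<tau> \<mu>))}"

definition supported_on :: "('a, 'm) monoid_scheme \<Rightarrow> (complex \<Rightarrow> 'a \<Rightarrow> complex) \<Rightarrow> 'a set \<Rightarrow> bool" where
  "supported_on A f X \<longleftrightarrow> (\<forall>\<mu>\<in>carrier A - X. \<forall>\<tau>\<in>\<H>. f \<tau> \<mu> = 0)"

text \<open>
  The elements of \<open>H\<^sup>\<bottom>/H\<close> are the cosets \<open>H #>\<^bsub>A\<^esub> \<mu>\<close> for \<open>\<mu>\<close> in \<^term>\<open>perp A Q H\<close>, i.e. \<open>\<mu> + H\<close>.
\<close>

definition down :: "('a, 'm) monoid_scheme \<Rightarrow> ('a \<Rightarrow> rat_mod_int) \<Rightarrow> 'a set \<Rightarrow>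
    (complex \<Rightarrow> 'a \<Rightarrow> complex) \<Rightarrow> (complex \<Rightarrow> 'a set \<Rightarrow> complex)" where
  "down A Q H f = (\<lambda>\<tau> \<beta>. \<Sum>\<mu>\<in>perp A Q H. f \<tau> \<mu> * basis_vec (H #>\<^bsub>A\<^esub> \<mu>) \<beta>)"

definition up :: "('a, 'm) monoid_scheme \<Rightarrow> ('a \<Rightarrow> rat_mod_int) \<Rightarrow> 'a set \<Rightarrow>
    (complex \<Rightarrow> 'a set \<Rightarrow> complex) \<Rightarrow> (complex \<Rightarrow> 'a \<Rightarrow> complex)" where
  "up A Q H g = (\<lambda>\<tau> \<nu>. \<Sum>\<mu>\<in>perp A Q H. g \<tau> (H #>\<^bsub>A\<^esub> \<mu>) * basis_vec \<mu> \<nu>)"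

end

theory Submission
  imports Defs "HOL-Algebra.Generated_Groups"
begin

text \<open>
  Let \<open>P\<close> be the union of the \<open>H\<^sub>i\<^sup>\<bottom>\<close>. Since \<open>f(-1/\<tau>)\<close> is supported on \<open>P\<close>, the \<open>S\<close>-transformation writes
  \<open>f(\<tau>)\<close> as a combination of the characters \<open>e(-(\<mu>, \<cdot>))\<close> with \<open>\<mu> \<in> P\<close>. Such a character is trivial on some
  \<open>H\<^sub>i\<close>, so it is killed by \<open>\<Prod>\<^sub>i (1 - A\<^sub>i)\<close>, where \<open>A\<^sub>i\<close> averages over translates by \<open>H\<^sub>i\<close>. Expanding the product,
  the alternating sum over all \<open>S\<close> of the averages of \<open>f(\<tau>)\<close> over \<open>x + H\<^sub>S\<close> vanishes.

  Replacing \<open>\<tau>\<close> by \<open>\<tau> + n\<close> multiplies \<open>f\<^sub>\<lambda>\<close> by \<open>e(n Q(\<lambda>))\<close>, so the vanishing persists when only the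
  \<open>y \<in> H\<^sub>S\<close> with \<open>Q(x + y) = Q(x)\<close> are kept. By coprimality of the \<open>p\<^sub>i\<close> these are the elements of \<open>H\<^sub>S\<^sub>\<inter>\<^sub>J\<close>,
  \<open>J = {i. x \<in> H\<^sub>i\<^sup>\<bottom>}\<close>. The nonzero factor \<open>\<Prod>\<^sub>i\<^sub>\<notin>\<^sub>J (1 - 1/p\<^sub>i)\<close> splits off, and the remaining sum over
  \<open>S \<subseteq> J\<close> is the claimed identity at \<open>x\<close>.
\<close>

section \<open>Subgroups and elements of coprime order\<close>

text \<open>Bezout writes the exponent 1 as an integer combination of n and m, so z is a product of
  integer powers of two elements of K.\<close>

lemma (in comm_group) mem_subgroup_of_coprime_pow:
  fixes m n :: nat
  assumes K: "subgroup K G" and z: "z \<in> carrier G"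
    and "z [^] n \<in> K" "z [^] m \<in> K" "coprime n m"
  shows "z \<in> K"
proof -
  obtain u v where uv: "u * int n + v * int m = 1"
    using bezout_int[of "int n" "int m"] \<open>coprime n m\<close> by (auto simp: coprime_iff_gcd_eq_1)
  have "z = z [^] (int n * u + int m * v)"
    using uv z by (simp add: mult.commute)
  also have "\<dots> = (z [^] n) [^] u \<otimes> (z [^] m) [^] v"
    using z by (simp add: int_pow_mult int_pow_pow flip: int_pow_int)
  also have "\<dots> \<in> K"
    using assms by (intro subgroup.m_closed[OF K] subgroup_int_pow_closed[OF K])
  finally show ?thesis .
qed

lemma (in comm_group) pow_prod_finprod_eq_one:
  fixes n :: "'i \<Rightarrow> nat"
  assumes "finite S" "z \<in> S \<rightarrow> carrier G" "\<And>i. i \<in> S \<Longrightarrow> z i [^] n i = \<one>"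
  shows "finprod G z S [^] (\<Prod>i\<in>S. n i) = \<one>"
  using assms
proof (induction S)
  case (insert i S)
  let ?P = "\<Prod>i\<in>S. n i"
  have zi: "z i \<in> carrier G" and r: "finprod G z S \<in> carrier G"
    using insert.prems by (auto intro!: finprod_closed)
  have IH: "finprod G z S [^] ?P = \<one>"
    using insert.prems insert.IH by auto
  have "finprod G z (insert i S) [^] (n i * ?P) = (z i [^] n i) [^] ?P \<otimes> (finprod G z S [^] ?P) [^] n i"
    using insert.hyps insert.prems(1) zi r
    by (simp add: nat_pow_distrib nat_pow_pow Pi_def mult.commute)
  also have "\<dots> = \<one>"
    using IH insert.prems by simp
  finally show ?case
    using insert.hyps by simp
qed simp

text \<open>Raising the whole product to the power M, the product of the other exponents, kills
  every factor except z i. Since M is coprime to n i, \<open>mem_subgroup_of_coprime_pow\<close>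
  recovers z i from its M-th power.\<close>

lemma (in comm_group) mem_subgroup_of_finprod_mem:
  fixes n :: "'i \<Rightarrow> nat"
  assumes K: "subgroup K G" and S: "finite S" and z: "z \<in> S \<rightarrow> carrier G"
    and ord: "\<And>i. i \<in> S \<Longrightarrow> z i [^] n i = \<one>"
    and cop: "\<And>i j. i \<in> S \<Longrightarrow> j \<in> S \<Longrightarrow> i \<noteq> j \<Longrightarrow> coprime (n i) (n j)"
    and mem: "finprod G z S \<in> K" and i: "i \<in> S"
  shows "z i \<in> K"
proof -
  let ?M = "\<Prod>j\<in>S - {i}. n j" and ?r = "finprod G z (S - {i})"
  have zi: "z i \<in> carrier G" and r: "?r \<in> carrier G"
    using z i by (auto intro!: finprod_closed)
  have "finprod G z S = z i \<otimes> ?r"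
    using S z i finprod_insert[of "S - {i}" i z] by (auto simp: insert_absorb Pi_def)
  moreover have "?r [^] ?M = \<one>"
    using S z ord by (intro pow_prod_finprod_eq_one) auto
  ultimately have "finprod G z S [^] ?M = z i [^] ?M"
    using zi r by (simp add: nat_pow_distrib)
  then have "z i [^] ?M \<in> K"
    using subgroup_int_pow_closed[OF K mem, of "int ?M"] by (simp add: int_pow_int del: of_nat_prod)
  moreover have "coprime (n i) ?M"
    using cop i by (intro prod_coprime_right) auto
  moreover have "z i [^] n i \<in> K"
    using ord[OF i] subgroup.one_closed[OF K] by simp
  ultimately show ?thesis
    using mem_subgroup_of_coprime_pow[OF K zi] by blast
qed

lemma (in comm_group) pow_card_subgroup_eq_one:
  assumes "subgroup H G" "x \<in> H" "finite H"
  shows "x [^] card H = \<one>"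
proof -
  interpret H: comm_group "G\<lparr>carrier := H\<rparr>"
    using subgroup.subset[OF assms(1)] subgroup_imp_group[OF assms(1)]
    by (intro group.group_comm_groupI) (auto simp: m_comm subset_iff)
  show ?thesis
    using H.power_order_eq_one[of x] assms by (simp flip: nat_pow_consistent)
qed

section \<open>Sums\<close>

text \<open>Splitting S into its parts outside and inside J separates the variables: F sees only the
  inside part, and the sum over the outside parts is the expansion of the product of the factors 1 +
  a i.\<close>

lemma sum_Pow_Int:
  fixes a :: "'i \<Rightarrow> 'b :: comm_ring_1"
  assumes I: "finite I" and J: "J \<subseteq> I"
  shows "(\<Sum>S\<in>Pow I. (\<Prod>i\<in>S. a i) * F (S \<inter> J))
    = (\<Prod>i\<in>I - J. 1 + a i) * (\<Sum>S\<in>Pow J. (\<Prod>i\<in>S. a i) * F S)"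
proof -
  have fin: "finite J" "finite (I - J)"
    using I J finite_subset by auto
  have "(\<Sum>S\<in>Pow I. (\<Prod>i\<in>S. a i) * F (S \<inter> J))
      = (\<Sum>(X, Y)\<in>Pow (I - J) \<times> Pow J. (\<Prod>i\<in>X. a i) * ((\<Prod>i\<in>Y. a i) * F Y))"
  proof (rule sum.reindex_bij_witness[where i = "\<lambda>(X, Y). X \<union> Y" and j = "\<lambda>S. (S - J, S \<inter> J)"])
    fix S assume "S \<in> Pow I"
    then have "finite S"
      using I finite_subset by auto
    then have "(\<Prod>i\<in>S. a i) = (\<Prod>i\<in>S - J. a i) * (\<Prod>i\<in>S \<inter> J. a i)"
      by (subst prod.Int_Diff[where B = J]) (simp_all add: mult.commute)
    then show "(case (S - J, S \<inter> J) of (X, Y) \<Rightarrow> (\<Prod>i\<in>X. a i) * ((\<Prod>i\<in>Y. a i) * F Y))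
        = (\<Prod>i\<in>S. a i) * F (S \<inter> J)"
      by (simp add: mult.assoc)
  qed (use J in auto)
  also have "\<dots> = (\<Sum>X\<in>Pow (I - J). \<Prod>i\<in>X. a i) * (\<Sum>S\<in>Pow J. (\<Prod>i\<in>S. a i) * F S)"
    by (simp add: sum_product sum.cartesian_product)
  also have "(\<Sum>X\<in>Pow (I - J). \<Prod>i\<in>X. a i) = (\<Prod>i\<in>I - J. 1 + a i)"
    using prod_add[OF fin(2), of a "\<lambda>_. 1"] by (simp add: add.commute)
  finally show ?thesis .
qed

text \<open>Discrete Fourier inversion: the sum of (z t / a)^n over n < N is N if z t = a and a
  vanishing geometric sum otherwise.\<close>

lemma sum_root_of_unity_filter:
  fixes z c :: "'t \<Rightarrow> complex"
  assumes X: "finite X" and N: "N > 0" and a: "a ^ N = 1" and z: "\<And>t. t \<in> X \<Longrightarrow> z t ^ N = 1"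
    and zero: "\<And>n. (\<Sum>t\<in>X. c t * z t ^ n) = 0"
  shows "(\<Sum>t\<in>{t\<in>X. z t = a}. c t) = 0"
proof -
  have a0: "a \<noteq> 0"
    using a N by (auto simp: power_0_left)
  have geo: "(\<Sum>n<N. (z t / a) ^ n) = (if z t = a then of_nat N else 0)" if "t \<in> X" for t
  proof (cases "z t = a")
    case False
    then have "z t / a \<noteq> 1"
      using a0 by simp
    then show ?thesis
      using False z[OF that] a by (subst geometric_sum) (simp_all add: power_divide)
  qed (use a0 in simp)
  have "0 = (\<Sum>n<N. (\<Sum>t\<in>X. c t * z t ^ n) / a ^ n)"
    using zero by simp
  also have "\<dots> = (\<Sum>t\<in>X. c t * (\<Sum>n<N. (z t / a) ^ n))"
    unfolding sum_divide_distrib sum_distrib_left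
    by (subst sum.swap) (simp add: power_divide)
  also have "\<dots> = (\<Sum>t\<in>X. if z t = a then c t * of_nat N else 0)"
    by (rule sum.cong) (simp_all add: geo)
  also have "\<dots> = (\<Sum>t\<in>{t\<in>X. z t = a}. c t) * of_nat N"
    using X by (simp add: sum.inter_filter sum_distrib_right if_distrib [of "\<lambda>c. c * _"] cong: if_cong)
  finally show ?thesis
    using N by simp
qed

section \<open>The character $e$\<close>

lemma exp2pi_add: "exp2pi (x + y) = exp2pi x * exp2pi y"
  by (simp add: exp2pi_def ring_distribs exp_add)

lemma exp2pi_mod_add: "exp2pi_mod (x + y) = exp2pi_mod x * exp2pi_mod y"
  by transfer (simp add: of_rat_add exp2pi_add)

lemma exp2pi_mod_0 [simp]: "exp2pi_mod 0 = 1"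
  by transfer (simp add: exp2pi_def)

lemma exp2pi_mod_nonzero [simp]: "exp2pi_mod x \<noteq> 0"
  by transfer (simp add: exp2pi_def)

lemma exp2pi_mod_eq_1_iff: "exp2pi_mod x = 1 \<longleftrightarrow> x = 0"
proof
  assume "exp2pi_mod x = 1"
  then show "x = 0"
  proof transfer
    fix x :: rat
    assume "exp2pi (of_rat x) = 1"
    then obtain n :: int where "2 * pi * Re (of_rat x) = of_int (2 * n) * pi"
      unfolding exp2pi_def exp_eq_1 by auto
    then have "Re (of_rat x) = of_int n"
      by simp
    moreover have "Re (of_rat x) = of_rat x"
      by (cases x) (simp add: of_rat_rat)
    ultimately have "(of_rat x :: real) = of_rat (of_int n)"
      by simp
    then have "x = of_int n"
      by (simp only: of_rat_eq_iff)
    then show "x - 0 \<in> \<int>"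
      by simp
  qed
qed simp

text \<open>Faithfulness of the character turns a coincidence of T-eigenvalues back into a
  coincidence of values of Q.\<close>

lemma exp2pi_mod_eq_iff: "exp2pi_mod x = exp2pi_mod y \<longleftrightarrow> x = y"
proof -
  have "exp2pi_mod x = exp2pi_mod (x - y) * exp2pi_mod y"
    by (simp flip: exp2pi_mod_add)
  then show ?thesis
    using exp2pi_mod_eq_1_iff[of "x - y"] by auto
qed

lemma exp2pi_mod_int_scale: "exp2pi_mod (int_scale (int n) x) = exp2pi_mod x ^ n"
  by transfer (simp add: exp2pi_def of_rat_mult mult_ac flip: exp_of_nat_mult)


section \<open>Discriminant forms\<close>

context discriminant_form
begin

lemma bilin_commute: "x \<in> carrier A \<Longrightarrow> y \<in> carrier A \<Longrightarrow> bilin A Q x y = bilin A Q y x"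
  by (simp add: bilin_def m_comm)

lemma bilin_mult_right:
  "x \<in> carrier A \<Longrightarrow> y \<in> carrier A \<Longrightarrow> z \<in> carrier A
    \<Longrightarrow> bilin A Q x (y \<otimes> z) = bilin A Q x y + bilin A Q x z"
  by (simp add: bilin_commute[of x] bilinear)

lemma bilin_one_right: "x \<in> carrier A \<Longrightarrow> bilin A Q x \<one> = 0"
  using bilin_mult_right[of x \<one> \<one>] by simp

lemma Q_one: "Q \<one> = 0"
  using bilin_one_right[of \<one>] by (simp add: bilin_def)

lemma Q_mult: "Q (x \<otimes> y) = Q x + Q y + bilin A Q x y"
  by (simp add: bilin_def)

lemma subgroup_perp:
  assumes X: "X \<subseteq> carrier A"
  shows "subgroup (perp A Q X) A"
proof (rule subgroupI)
  show "perp A Q X \<subseteq> carrier A"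
    by (auto simp: perp_def)
  show "perp A Q X \<noteq> {}"
    using X by (auto simp: perp_def bilin_one_right bilin_commute[of \<one>] intro!: exI[of _ \<one>])
next
  fix x assume "x \<in> perp A Q X"
  then have x: "x \<in> carrier A" "\<And>h. h \<in> X \<Longrightarrow> bilin A Q x h = 0"
    by (auto simp: perp_def)
  have "bilin A Q (inv x) h = 0" if "h \<in> X" for h
    using bilinear[of x "inv x" h] bilin_one_right[of h] bilin_commute[of h \<one>] x that X
    by auto
  then show "inv x \<in> perp A Q X"
    using x by (auto simp: perp_def)
next
  fix x y assume "x \<in> perp A Q X" "y \<in> perp A Q X"
  then show "x \<otimes> y \<in> perp A Q X"
    using X by (auto simp: perp_def bilinear subset_iff)
qed

text \<open>Symmetry of the form moves the condition onto X. Containment in the single subgroup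
  \<open>perp A Q {x}\<close> can then be tested component by component.\<close>

lemma mem_perp_iff_subset:
  "x \<in> carrier A \<Longrightarrow> X \<subseteq> carrier A \<Longrightarrow> x \<in> perp A Q X \<longleftrightarrow> X \<subseteq> perp A Q {x}"
  unfolding perp_def using bilin_commute[of x] by fastforce

lemma isotropic_subset_perp:
  assumes "isotropic A Q H"
  shows "H \<subseteq> perp A Q H"
proof -
  have "subgroup H A" "\<And>x. x \<in> H \<Longrightarrow> Q x = 0"
    using assms by (auto simp: isotropic_def)
  then show ?thesis
    by (auto simp: perp_def bilin_def subgroup.m_closed dest: subgroup.mem_carrier)
qed

text \<open>For N the order of A, N^2 Q(x) = Q(Nx) = Q(0) = 0. The exponent N^2 serves all x at
  once, as the root-of-unity filter requires.\<close>

lemma exp2pi_mod_Q_pow: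
  assumes "x \<in> carrier A"
  shows "exp2pi_mod (Q x) ^ ((order A)\<^sup>2) = 1"
proof -
  have "exp2pi_mod (Q x) ^ ((order A)\<^sup>2) = exp2pi_mod (int_scale ((int (order A))\<^sup>2) (Q x))"
    using exp2pi_mod_int_scale[of "(order A)\<^sup>2" "Q x"] by simp
  also have "\<dots> = exp2pi_mod (Q (x [^] int (order A)))"
    using quadratic assms by simp
  also have "\<dots> = 1"
    using assms using power_order_eq_one[OF finite_carrier] by (simp add: int_pow_int order_def Q_one)
  finally show ?thesis .
qed

text \<open>Orthogonality of characters: if some h in K has nontrivial character value, translating
  the summation by h multiplies the sum by that value, so the sum vanishes.\<close>

lemma sum_character:
  assumes K: "subgroup K A" and x: "x \<in> carrier A"
  shows "(\<Sum>y\<in>K. exp2pi_mod (- bilin A Q x y)) = (if x \<in> perp A Q K then of_nat (card K) else 0)"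
proof (cases "x \<in> perp A Q K")
  case True
  then show ?thesis
    by (simp add: perp_def)
next
  case False
  have sub: "K \<subseteq> carrier A"
    using K by (rule subgroup.subset)
  let ?\<chi> = "\<lambda>y. exp2pi_mod (- bilin A Q x y)"
  obtain h where h: "h \<in> K" "bilin A Q x h \<noteq> 0"
    using False x by (auto simp: perp_def)
  have "bij_betw ((\<otimes>) h) K K"
    by (rule bij_betw_byWitness[where f' = "(\<otimes>) (inv h)"])
      (use h sub K in \<open>auto simp: m_assoc [symmetric] subset_iff subgroup.m_closed subgroup.m_inv_closed\<close>)
  then have "(\<Sum>y\<in>K. ?\<chi> y) = (\<Sum>y\<in>K. ?\<chi> (h \<otimes> y))"
    by (rule sum.reindex_bij_betw [symmetric])
  also have "\<dots> = ?\<chi> h * (\<Sum>y\<in>K. ?\<chi> y)"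
    using h x sub by (auto simp: sum_distrib_left bilin_mult_right subset_iff simp flip: exp2pi_mod_add
        intro!: sum.cong)
  finally have "(\<Sum>y\<in>K. ?\<chi> y) * (1 - ?\<chi> h) = 0"
    by (simp add: algebra_simps)
  moreover have "?\<chi> h \<noteq> 1"
    using h by (simp add: exp2pi_mod_eq_1_iff)
  ultimately show ?thesis
    using False by simp
qed

text \<open>The indicator in \<open>up\<close> selects x, and the one in \<open>down\<close> selects
  all representatives of the coset of x. Isotropy puts this whole coset inside H^perp, so the sum
  runs over every translate of x by H.\<close>

lemma up_down:
  assumes H: "isotropic A Q H"
  shows "up A Q H (down A Q H f) \<tau> x = (if x \<in> perp A Q H then \<Sum>y\<in>H. f \<tau> (y \<otimes> x) else 0)"
proof -
  have sub: "subgroup H A"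
    using H by (simp add: isotropic_def)
  then have Hc: "H \<subseteq> carrier A"
    by (rule subgroup.subset)
  have P: "subgroup (perp A Q H) A"
    using Hc by (rule subgroup_perp)
  have finP: "finite (perp A Q H)"
    using finite_carrier subgroup.subset[OF P] finite_subset by blast
  have "up A Q H (down A Q H f) \<tau> x = (if x \<in> perp A Q H then down A Q H f \<tau> (H #> x) else 0)"
    using finP by (simp add: up_def basis_vec_def if_distrib sum.delta cong: if_cong)
  moreover have "down A Q H f \<tau> (H #> x) = (\<Sum>y\<in>H. f \<tau> (y \<otimes> x))" if x: "x \<in> perp A Q H"
  proof -
    have xc: "x \<in> carrier A"
      using x by (simp add: perp_def)
    have "down A Q H f \<tau> (H #> x) = (\<Sum>\<mu> | \<mu> \<in> perp A Q H \<and> H #> x = H #> \<mu>. f \<tau> \<mu>)"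
      using finP by (simp add: down_def basis_vec_def if_distrib sum.inter_filter cong: if_cong)
    also have "{\<mu>. \<mu> \<in> perp A Q H \<and> H #> x = H #> \<mu>} = H #> x"
    proof (intro equalityI subsetI)
      fix \<mu> assume "\<mu> \<in> {\<mu>. \<mu> \<in> perp A Q H \<and> H #> x = H #> \<mu>}"
      then show "\<mu> \<in> H #> x"
        using repr_independenceD[OF sub] subgroup.mem_carrier[OF P] by auto
    next
      fix \<mu> assume \<mu>: "\<mu> \<in> H #> x"
      then have "H #> x = H #> \<mu>"
        using repr_independence xc sub by blast
      moreover have "\<mu> \<in> perp A Q H"
        using \<mu> x isotropic_subset_perp[OF H] by (auto simp: r_coset_def subgroup.m_closed[OF P] subset_iff)
      ultimately show "\<mu> \<in> {\<mu>. \<mu> \<in> perp A Q H \<and> H #> x = H #> \<mu>}"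
        by simp
    qed
    also have "sum (f \<tau>) (H #> x) = sum (f \<tau>) ((\<lambda>y. y \<otimes> x) ` H)"
      by (rule arg_cong[where f = "sum (f \<tau>)"]) (auto simp: r_coset_def)
    also have "\<dots> = (\<Sum>y\<in>H. f \<tau> (y \<otimes> x))"
      using Hc xc by (subst sum.reindex) (auto intro!: inj_onI simp: subset_iff)
    finally show ?thesis .
  qed
  ultimately show ?thesis
    by simp
qed

end


section \<open>Families of isotropic subgroups of distinct prime orders\<close>

text \<open>By Lagrange the order of the intersection divides a prime, and y rules out order
  1.\<close>

lemma (in group) subset_of_prime_card:
  assumes H: "subgroup H G" and K: "subgroup K G" and p: "prime (card H)"
    and y: "y \<in> H" "y \<in> K" "y \<noteq> \<one>"
  shows "H \<subseteq> K"
proof -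
  interpret H: group "G\<lparr>carrier := H\<rparr>"
    using H by (rule subgroup_imp_group)
  have "subgroup (H \<inter> K) (G\<lparr>carrier := H\<rparr>)"
    using H K by (intro subgroup_incl subgroups_Inter_pair) auto
  then have "card H = card (rcosets\<^bsub>G\<lparr>carrier := H\<rparr>\<^esub> (H \<inter> K)) * card (H \<inter> K)"
    using H.lagrange[of "H \<inter> K"] by (simp add: order_def)
  then have "card (H \<inter> K) dvd card H"
    by (rule dvdI[where k = "card (rcosets\<^bsub>G\<lparr>carrier := H\<rparr>\<^esub> (H \<inter> K))", OF trans]) simp
  then have "card (H \<inter> K) = 1 \<or> card (H \<inter> K) = card H"
    using p by (simp add: prime_nat_iff)
  moreover have "card (H \<inter> K) \<noteq> 1"
    using y subgroup.one_closed[OF H] subgroup.one_closed[OF K]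
    by (metis IntI card_1_singletonE singletonD)
  moreover have "finite H"
    using p by (metis card.infinite not_prime_0)
  ultimately show ?thesis
    by (metis Int_lower1 card_subset_eq inf.absorb_iff1)
qed

lemma (in comm_group) subgroup_finprod_closed:
  assumes K: "subgroup K G" and z: "z \<in> S \<rightarrow> K"
  shows "finprod G z S \<in> K"
  using z
proof (induction S rule: infinite_finite_induct)
  case (insert i S)
  then have "z \<in> S \<rightarrow> carrier G" "z i \<in> carrier G"
    using subgroup.mem_carrier[OF K] by (auto simp: Pi_iff)
  then show ?case
    using insert subgroup.m_closed[OF K] by simp
qed (use subgroup.one_closed[OF K] in auto)

lemma (in discriminant_form) bilin_pow_swap:
  assumes "x \<in> carrier A" "y \<in> carrier A"
  shows "bilin A Q (x [^] (n::nat)) y = bilin A Q x (y [^] n)"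
  using assms
  by (induction n) (simp_all add: bilin_one_right bilin_commute[of \<one>] bilinear bilin_mult_right)

locale isotropic_family = discriminant_form +
  fixes H :: "'i \<Rightarrow> 'a set" and p :: "'i \<Rightarrow> nat" and I :: "'i set"
  assumes finite_index: "finite I"
    and isotropic_H: "i \<in> I \<Longrightarrow> isotropic A Q (H i)"
    and card_H: "i \<in> I \<Longrightarrow> card (H i) = p i"
    and prime_p: "i \<in> I \<Longrightarrow> prime (p i)"
    and distinct_p: "i \<in> I \<Longrightarrow> j \<in> I \<Longrightarrow> i \<noteq> j \<Longrightarrow> p i \<noteq> p j"
begin

section \<open>The sums H_S: order, isotropy and orthogonality\<close>

abbreviation HS :: "'i set \<Rightarrow> 'a set" where
  "HS S \<equiv> subgroup_sum A H S"

lemma subgroup_H: "i \<in> I \<Longrightarrow> subgroup (H i) A"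
  using isotropic_H by (simp add: isotropic_def)

lemma H_subset_carrier: "i \<in> I \<Longrightarrow> H i \<subseteq> carrier A"
  using subgroup_H by (rule subgroup.subset)

lemma Pi_H_carrier: "S \<subseteq> I \<Longrightarrow> h \<in> Pi S H \<Longrightarrow> h \<in> S \<rightarrow> carrier A"
  using H_subset_carrier by blast

lemma pow_p_eq_one: "i \<in> I \<Longrightarrow> y \<in> H i \<Longrightarrow> y [^] p i = \<one>"
  using pow_card_subgroup_eq_one[OF subgroup_H] card_H finite_carrier H_subset_carrier finite_subset
  by metis

lemma coprime_p: "i \<in> I \<Longrightarrow> j \<in> I \<Longrightarrow> i \<noteq> j \<Longrightarrow> coprime (p i) (p j)"
  using primes_coprime prime_p distinct_p by blast

lemma finite_index_subset: "S \<subseteq> I \<Longrightarrow> finite S"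
  using finite_index finite_subset by blast

text \<open>Two choices of K matter below: the trivial subgroup gives uniqueness of components, and
  x^perp gives orthogonality component by component.\<close>

lemma mem_subgroup_of_finprod_H_mem:
  assumes "S \<subseteq> I" "h \<in> Pi S H" "subgroup K A" "finprod A h S \<in> K" "i \<in> S"
  shows "h i \<in> K"
  using assms
  by (intro mem_subgroup_of_finprod_mem[of K S h p i] finite_index_subset Pi_H_carrier)
    (auto intro!: pow_p_eq_one coprime_p)

lemma subgroup_HS:
  assumes S: "S \<subseteq> I"
  shows "subgroup (HS S) A"
proof (rule subgroupI)
  show "HS S \<subseteq> carrier A"
    using Pi_H_carrier[OF S] by (auto simp: subgroup_sum_def intro!: finprod_closed)
  have "(\<lambda>_. \<one>) \<in> Pi S H"
    using S by (auto simp: subset_iff intro: subgroup.one_closed[OF subgroup_H])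
  then show "HS S \<noteq> {}"
    by (auto simp: subgroup_sum_def)
next
  fix y assume "y \<in> HS S"
  then obtain h where h: "h \<in> Pi S H" "y = finprod A h S"
    by (auto simp: subgroup_sum_def)
  have hc: "h \<in> S \<rightarrow> carrier A"
    using Pi_H_carrier S h by blast
  have "(\<Otimes>i\<in>S. inv (h i)) \<otimes> y = (\<Otimes>i\<in>S. inv (h i) \<otimes> h i)"
    using hc h by (subst finprod_multf) auto
  also have "\<dots> = \<one>"
    using hc by (intro finprod_one_eqI) (auto simp: Pi_iff)
  finally have "inv y = (\<Otimes>i\<in>S. inv (h i))"
    using hc h by (intro inv_equality) (auto intro!: finprod_closed)
  moreover have "(\<lambda>i. inv (h i)) \<in> Pi S H"
    using h S by (auto simp: subset_iff Pi_iff intro: subgroup.m_inv_closed[OF subgroup_H])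
  ultimately show "inv y \<in> HS S"
    by (auto simp: subgroup_sum_def)
next
  fix y z assume "y \<in> HS S" "z \<in> HS S"
  then obtain h k where h: "h \<in> Pi S H" "y = finprod A h S" and k: "k \<in> Pi S H" "z = finprod A k S"
    by (auto simp: subgroup_sum_def)
  then have "y \<otimes> z = (\<Otimes>i\<in>S. h i \<otimes> k i)"
    using Pi_H_carrier S by (simp add: finprod_multf)
  moreover have "(\<lambda>i. h i \<otimes> k i) \<in> Pi S H"
    using h k S by (auto simp: subset_iff Pi_iff intro: subgroup.m_closed[OF subgroup_H])
  ultimately show "y \<otimes> z \<in> HS S"
    by (auto simp: subgroup_sum_def)
qed

lemma HS_subset_carrier: "S \<subseteq> I \<Longrightarrow> HS S \<subseteq> carrier A"
  using subgroup_HS by (rule subgroup.subset)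

lemma H_subset_HS:
  assumes S: "S \<subseteq> I" and i: "i \<in> S"
  shows "H i \<subseteq> HS S"
proof
  fix y assume y: "y \<in> H i"
  let ?h = "\<lambda>j. if i = j then y else \<one>"
  have "?h \<in> Pi S H"
    using y S subgroup.one_closed[OF subgroup_H] by (simp add: subset_iff Pi_iff)
  moreover have "finprod A ?h S = y"
    using finprod_singleton[OF i finite_index_subset[OF S], of "\<lambda>_. y"] H_subset_carrier[of i] i y S
    by (simp add: subset_iff)
  ultimately have "\<exists>h. y = finprod A h S \<and> h \<in> Pi S H"
    by (intro exI[of _ ?h]) simp
  then show "y \<in> HS S"
    by (simp add: subgroup_sum_def)
qed

lemma HS_subset_iff:
  assumes S: "S \<subseteq> I" and K: "subgroup K A"
  shows "HS S \<subseteq> K \<longleftrightarrow> (\<forall>i\<in>S. H i \<subseteq> K)"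
proof
  assume "\<forall>i\<in>S. H i \<subseteq> K"
  then show "HS S \<subseteq> K"
    using K by (auto simp: subgroup_sum_def intro!: subgroup_finprod_closed)
qed (use H_subset_HS[OF S] in blast)

lemma mem_perp_HS_iff:
  assumes S: "S \<subseteq> I" and x: "x \<in> carrier A"
  shows "x \<in> perp A Q (HS S) \<longleftrightarrow> (\<forall>i\<in>S. x \<in> perp A Q (H i))"
proof -
  have "x \<in> perp A Q (HS S) \<longleftrightarrow> HS S \<subseteq> perp A Q {x}"
    using mem_perp_iff_subset x HS_subset_carrier[OF S] by blast
  also have "\<dots> \<longleftrightarrow> (\<forall>i\<in>S. H i \<subseteq> perp A Q {x})"
    using x by (intro HS_subset_iff S subgroup_perp) auto
  also have "\<dots> \<longleftrightarrow> (\<forall>i\<in>S. x \<in> perp A Q (H i))"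
    using mem_perp_iff_subset[OF x H_subset_carrier] S by (intro ball_cong) auto
  finally show ?thesis .
qed

text \<open>The sum is direct. If two families have the same product, their componentwise quotients
  multiply to \<one>, and coprimality forces each quotient to be \<one>. Extensional families make
  the parametrization of H_S a bijection.\<close>

lemma card_HS:
  assumes S: "S \<subseteq> I"
  shows "card (HS S) = (\<Prod>i\<in>S. p i)"
proof -
  have "inj_on (\<lambda>h. finprod A h S) (Pi\<^sub>E S H)"
  proof (rule inj_onI)
    fix h k assume h: "h \<in> Pi\<^sub>E S H" and k: "k \<in> Pi\<^sub>E S H" and eq: "finprod A h S = finprod A k S"
    let ?l = "\<lambda>i. h i \<otimes> inv (k i)"
    have hc: "h \<in> S \<rightarrow> carrier A" and kc: "k \<in> S \<rightarrow> carrier A"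
      using h k Pi_H_carrier[OF S] by (auto simp: PiE_def)
    then have lc: "?l \<in> S \<rightarrow> carrier A"
      by auto
    have "finprod A ?l S \<otimes> finprod A k S = (\<Otimes>i\<in>S. ?l i \<otimes> k i)"
      using lc kc by (subst finprod_multf) auto
    also have "\<dots> = finprod A h S"
      using hc kc by (intro finprod_cong) (auto simp: m_assoc Pi_iff simp_implies_def)
    finally have "finprod A ?l S \<otimes> finprod A k S = \<one> \<otimes> finprod A k S"
      using eq kc by (simp add: finprod_closed)
    then have "finprod A ?l S = \<one>"
      using lc kc by (subst (asm) right_cancel) (auto intro!: finprod_closed)
    moreover have "?l \<in> Pi S H"
    proof
      fix i assume "i \<in> S"
      then have "subgroup (H i) A" "h i \<in> H i" "k i \<in> H i"
        using S h k subgroup_H by auto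
      then show "?l i \<in> H i"
        by (simp add: subgroup.m_closed subgroup.m_inv_closed)
    qed
    ultimately have "?l i = \<one>" if "i \<in> S" for i
      using mem_subgroup_of_finprod_H_mem[OF S _ triv_subgroup _ that, of ?l] by simp
    then have "h i = k i" if "i \<in> S" for i
      using that hc kc by (metis Pi_mem inv_closed inv_equality inv_inv)
    then show "h = k"
      using h k by (blast intro: PiE_ext)
  qed
  moreover have "(\<lambda>h. finprod A h S) ` (Pi\<^sub>E S H) = HS S"
  proof (intro equalityI subsetI)
    fix y assume "y \<in> HS S"
    then obtain h where h: "h \<in> Pi S H" "y = finprod A h S"
      by (auto simp: subgroup_sum_def)
    then have "y = finprod A (restrict h S) S"
      using Pi_H_carrier[OF S] by (auto intro!: finprod_cong simp: simp_implies_def)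
    moreover have "restrict h S \<in> Pi\<^sub>E S H"
      using h by auto
    ultimately show "y \<in> (\<lambda>h. finprod A h S) ` (Pi\<^sub>E S H)"
      by blast
  qed (auto simp: subgroup_sum_def PiE_def)
  ultimately have "card (HS S) = card (Pi\<^sub>E S H)"
    by (metis card_image)
  also have "\<dots> = (\<Prod>i\<in>S. p i)"
    using S card_H by (subst card_PiE) (auto intro!: prod.cong finite_index_subset)
  finally show ?thesis .
qed

text \<open>Written additively, p_j z = 0 and (y, p_i z) = (p_i y, z) = 0, so both multiples of z
  lie in y^perp; coprimality of p_i and p_j puts z there too.\<close>

lemma H_subset_perp_singleton:
  assumes i: "i \<in> I" and j: "j \<in> I" and ij: "i \<noteq> j" and y: "y \<in> H i"
  shows "H j \<subseteq> perp A Q {y}"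
proof
  fix z assume z: "z \<in> H j"
  have yc: "y \<in> carrier A" and zc: "z \<in> carrier A"
    using y z H_subset_carrier i j by auto
  have K: "subgroup (perp A Q {y}) A"
    using yc by (intro subgroup_perp) auto
  have "z [^] p j \<in> perp A Q {y}"
    using pow_p_eq_one[OF j z] subgroup.one_closed[OF K] by simp
  moreover have "z [^] p i \<in> perp A Q {y}"
    using yc zc pow_p_eq_one[OF i y] by (simp add: perp_def bilin_pow_swap bilin_one_right)
  ultimately show "z \<in> perp A Q {y}"
    using mem_subgroup_of_coprime_pow[OF K zc] coprime_p[OF j i] ij by blast
qed

text \<open>Adding one component at a time, the only obstruction to Q = 0 is the pairing of the new
  component with the earlier ones, and different H_i are mutually orthogonal.\<close>

lemma isotropic_HS:
  assumes S: "S \<subseteq> I"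
  shows "isotropic A Q (HS S)"
proof -
  have "Q (finprod A h S) = 0" if "h \<in> Pi S H" for h
    using finite_index_subset[OF S] S that
  proof (induction S)
    case (insert i S)
    let ?r = "finprod A h S"
    have hc: "h \<in> S \<rightarrow> carrier A" "h i \<in> carrier A" and hi: "h i \<in> H i"
      using insert.prems Pi_H_carrier[of "insert i S" h] by auto
    have "H j \<subseteq> perp A Q {h i}" if "j \<in> S" for j
      using H_subset_perp_singleton[of i j "h i"] that insert hi by auto
    then have "HS S \<subseteq> perp A Q {h i}"
      using insert.prems hc by (subst HS_subset_iff) (auto intro!: subgroup_perp)
    moreover have "?r \<in> HS S"
      using insert.prems by (auto simp: subgroup_sum_def)
    ultimately have "bilin A Q (h i) ?r = 0"
      using hc bilin_commute[of "h i" ?r] by (auto simp: perp_def)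
    moreover have "Q (h i) = 0"
      using isotropic_H[of i] insert.prems hi by (auto simp: isotropic_def)
    moreover have "Q ?r = 0"
      using insert by auto
    ultimately show ?case
      using insert.hyps hc by (simp add: Q_mult)
  qed (simp add: Q_one)
  then show ?thesis
    using subgroup_HS[OF S] by (auto simp: isotropic_def subgroup_sum_def)
qed

text \<open>If y is orthogonal to x, coprimality makes each of its components orthogonal to x. A
  nonzero component generates its group of prime order, so it can occur only at an index i with x in
  H_i^perp.\<close>

lemma HS_inter_perp:
  assumes S: "S \<subseteq> I" and x: "x \<in> carrier A"
  shows "{y \<in> HS S. bilin A Q x y = 0} = HS (S \<inter> {i\<in>I. x \<in> perp A Q (H i)})"
    (is "_ = HS (S \<inter> ?J)")
proof (intro equalityI subsetI)
  have SJ: "S \<inter> ?J \<subseteq> I"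
    using S by blast
  fix y assume y: "y \<in> HS (S \<inter> ?J)"
  have "HS (S \<inter> ?J) \<subseteq> HS S"
    using HS_subset_iff[OF SJ subgroup_HS[OF S]] H_subset_HS[OF S] by blast
  moreover have "x \<in> perp A Q (HS (S \<inter> ?J))"
    using mem_perp_HS_iff[OF SJ x] by blast
  ultimately show "y \<in> {y \<in> HS S. bilin A Q x y = 0}"
    using y by (auto simp: perp_def)
next
  fix y assume y: "y \<in> {y \<in> HS S. bilin A Q x y = 0}"
  then obtain h where h: "h \<in> Pi S H" "y = finprod A h S"
    by (auto simp: subgroup_sum_def)
  have K: "subgroup (perp A Q {x}) A"
    using x by (intro subgroup_perp) auto
  have yc: "y \<in> carrier A"
    using y HS_subset_carrier[OF S] by auto
  then have "y \<in> perp A Q {x}"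
    using y x bilin_commute[of x y] by (auto simp: perp_def)
  then have hK: "h i \<in> perp A Q {x}" if "i \<in> S" for i
    using mem_subgroup_of_finprod_H_mem[OF S h(1) K _ that] h(2) by simp
  have "h i = \<one>" if i: "i \<in> S - ?J" for i
  proof (rule ccontr)
    assume "h i \<noteq> \<one>"
    then have "H i \<subseteq> perp A Q {x}"
      using i S h hK prime_p card_H
      by (intro subset_of_prime_card[OF subgroup_H K, of _ "h i"]) auto
    then have "x \<in> perp A Q (H i)"
      using mem_perp_iff_subset[OF x] H_subset_carrier i S by blast
    then show False
      using i S by blast
  qed
  then have "finprod A h S = finprod A h (S \<inter> ?J)"
    using finite_index_subset[OF S] Pi_H_carrier[OF S h(1)]
    by (intro finprod_mono_neutral_cong_right) auto
  then show "y \<in> HS (S \<inter> ?J)"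
    using h by (auto simp: subgroup_sum_def)
qed

section \<open>Weighted alternating sums over the subgroups H_S\<close>

definition perp_index :: "'a \<Rightarrow> 'i set" where
  "perp_index x = {i\<in>I. x \<in> perp A Q (H i)}"

lemma perp_index_subset: "perp_index x \<subseteq> I"
  by (auto simp: perp_index_def)

text \<open>This is (-1)^|S| / |H_S|, the negative of the coefficient in the theorem. The product
  form over S is what allows \<open>sum_Pow_Int\<close> to factor the sum.\<close>

definition weight :: "'i set \<Rightarrow> complex" where
  "weight S = (\<Prod>i\<in>S. - 1 / of_nat (p i))"

lemma weight_eq: "S \<subseteq> I \<Longrightarrow> weight S = (-1) ^ card S / of_nat (card (HS S))"
  using prod_dividef[of "\<lambda>_. - 1" "\<lambda>i. of_nat (p i)" S] by (simp add: weight_def card_HS)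

lemma weight_times_card:
  assumes "S \<subseteq> I"
  shows "weight S * of_nat (card (HS S)) = (\<Prod>i\<in>S. -1)"
proof -
  have "card (HS S) > 0"
    using assms prime_gt_0_nat[OF prime_p] by (auto simp: card_HS intro!: prod_pos)
  then show ?thesis
    using assms by (simp add: weight_eq)
qed

text \<open>After inserting the expansion of w, the character of \<mu> summed over H_S is |H_S| or
  0, so S contributes (-1)^|S| exactly when S lies in \<open>perp_index \<mu>\<close>. These signs
  cancel unless that index set is empty, and then u \<mu> = 0.\<close>

lemma sum_weight_fourier_eq_zero:
  assumes u: "\<And>\<mu>. \<mu> \<in> carrier A - (\<Union>i\<in>I. perp A Q (H i)) \<Longrightarrow> u \<mu> = 0"
    and w: "\<And>x. x \<in> carrier A \<Longrightarrow> w x = (\<Sum>\<mu>\<in>carrier A. u \<mu> * exp2pi_mod (- bilin A Q \<mu> x))"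
    and x: "x \<in> carrier A"
  shows "(\<Sum>S\<in>Pow I. weight S * (\<Sum>y\<in>HS S. w (y \<otimes> x))) = 0"
proof -
  let ?e = "\<lambda>\<mu> y. exp2pi_mod (- bilin A Q \<mu> y)"
  let ?v = "\<lambda>\<mu>. u \<mu> * ?e \<mu> x"
  have "(\<Sum>y\<in>HS S. w (y \<otimes> x))
      = (\<Sum>\<mu>\<in>carrier A. ?v \<mu> * (if \<mu> \<in> perp A Q (HS S) then of_nat (card (HS S)) else 0))"
    if S: "S \<in> Pow I" for S
  proof -
    have SI: "S \<subseteq> I"
      using S by simp
    have "(\<Sum>y\<in>HS S. w (y \<otimes> x)) = (\<Sum>y\<in>HS S. \<Sum>\<mu>\<in>carrier A. ?v \<mu> * ?e \<mu> y)"
    proof (rule sum.cong)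
      fix y assume "y \<in> HS S"
      then have y: "y \<in> carrier A"
        using HS_subset_carrier[OF SI] by blast
      have "w (y \<otimes> x) = (\<Sum>\<mu>\<in>carrier A. u \<mu> * ?e \<mu> (y \<otimes> x))"
        using w x y by simp
      also have "\<dots> = (\<Sum>\<mu>\<in>carrier A. ?v \<mu> * ?e \<mu> y)"
        using x y by (intro sum.cong) (simp_all add: bilin_mult_right mult.assoc add.commute flip: exp2pi_mod_add)
      finally show "w (y \<otimes> x) = (\<Sum>\<mu>\<in>carrier A. ?v \<mu> * ?e \<mu> y)" .
    qed simp
    also have "\<dots> = (\<Sum>\<mu>\<in>carrier A. ?v \<mu> * (\<Sum>y\<in>HS S. ?e \<mu> y))"
      by (subst sum.swap) (simp add: sum_distrib_left)
    finally show ?thesis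
      using sum_character[OF subgroup_HS[OF SI]] by simp
  qed
  then have "(\<Sum>S\<in>Pow I. weight S * (\<Sum>y\<in>HS S. w (y \<otimes> x)))
      = (\<Sum>S\<in>Pow I. \<Sum>\<mu>\<in>carrier A. ?v \<mu> * (if \<mu> \<in> perp A Q (HS S) then weight S * of_nat (card (HS S)) else 0))"
    by (intro sum.cong) (auto simp: sum_distrib_left mult_ac intro!: sum.cong)
  also have "\<dots> = (\<Sum>\<mu>\<in>carrier A. ?v \<mu> *
      (\<Sum>S\<in>Pow I. if \<mu> \<in> perp A Q (HS S) then weight S * of_nat (card (HS S)) else 0))"
    by (subst sum.swap) (simp add: sum_distrib_left)
  also have "\<dots> = 0"
  proof (rule sum.neutral, rule ballI)
    fix \<mu> assume \<mu>: "\<mu> \<in> carrier A"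
    show "?v \<mu> * (\<Sum>S\<in>Pow I. if \<mu> \<in> perp A Q (HS S) then weight S * of_nat (card (HS S)) else 0) = 0"
    proof (cases "perp_index \<mu> = {}")
      case True
      then show ?thesis
        using u \<mu> by (auto simp: perp_index_def)
    next
      case False
      have fin: "finite (perp_index \<mu>)"
        using perp_index_subset finite_index_subset by blast
      have "(\<Sum>S\<in>Pow I. if \<mu> \<in> perp A Q (HS S) then weight S * of_nat (card (HS S)) else 0)
          = (\<Sum>S\<in>Pow I. if S \<subseteq> perp_index \<mu> then \<Prod>i\<in>S. -1 else 0)"
        using \<mu> by (intro sum.cong) (auto simp: weight_times_card mem_perp_HS_iff perp_index_def simp del: prod_constant)
      also have "\<dots> = (\<Sum>S\<in>Pow (perp_index \<mu>). \<Prod>i\<in>S. -1)"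
        using perp_index_subset[of \<mu>] finite_index
        by (subst sum.inter_filter [symmetric]) (auto intro!: sum.cong simp del: prod_constant)
      \<comment> \<open>The sum of signs over all subsets is the expansion of a nonempty product of
        factors -1 + 1.\<close>
      also have "\<dots> = 0"
        using prod_add[OF fin, of "\<lambda>_. - 1 :: complex" "\<lambda>_. 1"] False fin by (simp add: power_0_left)
      finally show ?thesis
        by simp
    qed
  qed
  finally show ?thesis .
qed

text \<open>Varying \<open>n\<close> isolates the translates \<open>y \<otimes> x\<close> with the same value of \<open>Q\<close> as \<open>x\<close>. As \<open>HS S\<close> is
  isotropic, these are the \<open>y\<close> orthogonal to \<open>x\<close>, hence the elements of \<open>HS (S \<inter> perp_index x)\<close>.\<close>

lemma sum_weight_perp_index_eq_zero:
  assumes zero: "\<And>n. (\<Sum>S\<in>Pow I. weight S * (\<Sum>y\<in>HS S. exp2pi_mod (Q (y \<otimes> x)) ^ n * g (y \<otimes> x))) = 0"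
    and x: "x \<in> carrier A"
  shows "(\<Sum>S\<in>Pow (perp_index x). weight S * (\<Sum>y\<in>HS S. g (y \<otimes> x))) = 0"
proof -
  \<comment> \<open>The filter acts on all pairs (S, y) simultaneously, because the vanishing is
    known only for the total over S and not for a single S.\<close>
  let ?X = "Sigma (Pow I) HS" and ?N = "(order A)\<^sup>2"
  let ?c = "\<lambda>(S, y). weight S * g (y \<otimes> x)" and ?z = "\<lambda>(S, y). exp2pi_mod (Q (y \<otimes> x))"
  have finHS: "finite (HS S)" if "S \<in> Pow I" for S
    using that HS_subset_carrier finite_carrier finite_subset by blast
  have "(\<Sum>t\<in>{t\<in>?X. ?z t = exp2pi_mod (Q x)}. ?c t) = 0"
  proof (rule sum_root_of_unity_filter)
    show "finite ?X"
      using finite_index finHS by auto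
    show "?N > 0"
      using finite_carrier by (auto simp: order_gt_0_iff_finite)
    show "exp2pi_mod (Q x) ^ ?N = 1"
      using x by (rule exp2pi_mod_Q_pow)
  next
    fix t assume "t \<in> ?X"
    then show "?z t ^ ?N = 1"
      using x HS_subset_carrier by (auto intro!: exp2pi_mod_Q_pow)
  next
    fix n
    show "(\<Sum>t\<in>?X. ?c t * ?z t ^ n) = 0"
      using zero[of n] finite_index finHS
      by (simp add: sum.Sigma sum_distrib_left mult_ac split_def)
  qed
  moreover have "{t\<in>?X. ?z t = exp2pi_mod (Q x)} = Sigma (Pow I) (\<lambda>S. HS (S \<inter> perp_index x))"
  proof -
    have "{y \<in> HS S. Q (y \<otimes> x) = Q x} = HS (S \<inter> perp_index x)" if S: "S \<subseteq> I" for S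
    proof -
      have "Q (y \<otimes> x) = Q x \<longleftrightarrow> bilin A Q x y = 0" if "y \<in> HS S" for y
        using isotropic_HS[OF S] HS_subset_carrier[OF S] that x
        by (auto simp: Q_mult isotropic_def bilin_commute[of y x])
      then have "{y \<in> HS S. Q (y \<otimes> x) = Q x} = {y \<in> HS S. bilin A Q x y = 0}"
        by blast
      then show ?thesis
        using HS_inter_perp[OF S x] by (simp add: perp_index_def)
    qed
    then have "Sigma (Pow I) (\<lambda>S. {y \<in> HS S. Q (y \<otimes> x) = Q x}) = Sigma (Pow I) (\<lambda>S. HS (S \<inter> perp_index x))"
      by (intro Sigma_cong) auto
    moreover have "{t\<in>?X. ?z t = exp2pi_mod (Q x)} = Sigma (Pow I) (\<lambda>S. {y \<in> HS S. Q (y \<otimes> x) = Q x})"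
      by (auto simp: exp2pi_mod_eq_iff)
    ultimately show ?thesis
      by simp
  qed
  moreover have "finite (HS (S \<inter> perp_index x))" if "S \<in> Pow I" for S
    using that by (intro finHS) auto
  ultimately have "0 = (\<Sum>S\<in>Pow I. weight S * (\<Sum>y\<in>HS (S \<inter> perp_index x). g (y \<otimes> x)))"
    using finite_index by (simp add: sum.Sigma [symmetric] sum_distrib_left)
  \<comment> \<open>The inner sum now depends on S only through its intersection with
    \<open>perp_index x\<close>, while the weight is still taken over all of S.\<close>
  also have "\<dots> = (\<Prod>i\<in>I - perp_index x. 1 + - 1 / of_nat (p i)) *
      (\<Sum>S\<in>Pow (perp_index x). weight S * (\<Sum>y\<in>HS S. g (y \<otimes> x)))"
    unfolding weight_def
    using sum_Pow_Int[OF finite_index perp_index_subset, of "\<lambda>i. - 1 / of_nat (p i)" "\<lambda>S. \<Sum>y\<in>HS S. g (y \<otimes> x)"] .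
  finally have "(\<Prod>i\<in>I - perp_index x. 1 + - 1 / of_nat (p i) :: complex) *
      (\<Sum>S\<in>Pow (perp_index x). weight S * (\<Sum>y\<in>HS S. g (y \<otimes> x))) = 0"
    by simp
  moreover have "1 + - 1 / (of_nat (p i) :: complex) \<noteq> 0" if "i \<in> I" for i
    using prime_gt_1_nat[OF prime_p[OF that]] by (auto simp: field_simps)
  then have "(\<Prod>i\<in>I - perp_index x. 1 + - 1 / of_nat (p i) :: complex) \<noteq> 0"
    using finite_index by (subst prod_zero_iff) blast+
  ultimately show ?thesis
    by (simp only: mult_eq_0_iff simp_thms)
qed

text \<open>A subset S not contained in \<open>perp_index x\<close> contributes 0, since x is then
  outside H_S^perp. The remaining terms are those of the hypothesis with opposite sign, except for S
  = {}.\<close>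

lemma sum_up_down_eq:
  assumes zero: "(\<Sum>S\<in>Pow (perp_index x). weight S * (\<Sum>y\<in>HS S. f \<tau> (y \<otimes> x))) = 0"
    and x: "x \<in> carrier A"
  shows "(\<Sum>S \<in> {S. S \<noteq> {} \<and> S \<subseteq> I}. (-1) ^ (card S + 1) * (1 / of_nat (card (HS S))) *
      up A Q (HS S) (down A Q (HS S) f) \<tau> x) = f \<tau> x"
proof -
  let ?F = "\<lambda>S. weight S * (\<Sum>y\<in>HS S. f \<tau> (y \<otimes> x))"
  have "(\<Sum>S \<in> {S. S \<noteq> {} \<and> S \<subseteq> I}. (-1) ^ (card S + 1) * (1 / of_nat (card (HS S))) *
      up A Q (HS S) (down A Q (HS S) f) \<tau> x)
    = (\<Sum>S \<in> {S. S \<noteq> {} \<and> S \<subseteq> I}. if S \<subseteq> perp_index x then - ?F S else 0)"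
  proof (rule sum.cong)
    fix S assume "S \<in> {S. S \<noteq> {} \<and> S \<subseteq> I}"
    then have S: "S \<subseteq> I"
      by simp
    have "x \<in> perp A Q (HS S) \<longleftrightarrow> S \<subseteq> perp_index x"
      using mem_perp_HS_iff[OF S x] S by (auto simp: perp_index_def)
    then show "(-1) ^ (card S + 1) * (1 / of_nat (card (HS S))) * up A Q (HS S) (down A Q (HS S) f) \<tau> x
        = (if S \<subseteq> perp_index x then - ?F S else 0)"
      by (simp add: up_down[OF isotropic_HS[OF S]] weight_eq[OF S])
  qed simp
  also have "\<dots> = (\<Sum>S\<in>Pow (perp_index x) - {{}}. - ?F S)"
    using perp_index_subset[of x] finite_index
    by (subst sum.inter_filter [symmetric]) (auto intro!: sum.cong)
  also have "\<dots> = - ((\<Sum>S\<in>Pow (perp_index x). ?F S) - ?F {})"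
    using finite_index_subset[OF perp_index_subset] by (simp add: sum_negf sum_diff1)
  \<comment> \<open>The term at S = {} equals f \<tau> x: its weight is the empty product 1 and its
    subgroup is trivial.\<close>
  also have "\<dots> = f \<tau> x"
    using zero x by (simp add: weight_def subgroup_sum_def)
  finally show ?thesis .
qed

end

section \<open>The action of $S$ and $T$\<close>

lemma mp_T_carrier: "mp_T \<in> carrier Mp2Z"
proof -
  have "(\<lambda>\<tau>\<in>\<H>. 1) holomorphic_on \<H>"
    by (rule holomorphic_transform[of "\<lambda>_. 1"]) auto
  then show ?thesis
    by (auto simp: mp_T_def Mp2Z_def det_2)
qed

lemma mp_S_carrier: "mp_S \<in> carrier Mp2Z"
proof -
  have "csqrt holomorphic_on \<H>"
    by (rule holomorphic_on_subset[OF holomorphic_on_csqrt])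
      (auto simp: upper_half_plane_def complex_nonpos_Reals_iff)
  then have "(\<lambda>\<tau>\<in>\<H>. csqrt \<tau>) holomorphic_on \<H>"
    by (rule holomorphic_transform) simp
  then show ?thesis
    by (auto simp: mp_S_def Mp2Z_def det_2)
qed

lemma GL_group_alg_linear:
  assumes "R \<in> carrier (GL_group_alg A)" "u \<in> group_alg A" "v \<in> group_alg A"
  shows "R (\<lambda>x. a * u x + b * v x) = (\<lambda>x. a * R u x + b * R v x)"
  using assms by (simp add: GL_group_alg_def)

lemma GL_group_alg_sum:
  assumes R: "R \<in> carrier (GL_group_alg A)" and "finite X" "X \<subseteq> carrier A"
  shows "R (\<lambda>x. \<Sum>l\<in>X. c l * basis_vec l x) = (\<lambda>x. \<Sum>l\<in>X. c l * R (basis_vec l) x)"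
  using assms(2,3)
proof (induction X)
  case empty
  have "(\<lambda>_. 0) \<in> group_alg A"
    by (simp add: group_alg_def)
  \<comment> \<open>Taking both coefficients to be zero yields R 0 = 0 from linearity on
    pairs.\<close>
  then show ?case
    using GL_group_alg_linear[OF R, of "\<lambda>_. 0" "\<lambda>_. 0" 0 0] by simp
next
  case (insert l X)
  let ?v = "\<lambda>x. \<Sum>l\<in>X. c l * basis_vec l x"
  have "basis_vec l \<in> group_alg A" "?v \<in> group_alg A"
    using insert.prems by (auto simp: group_alg_def basis_vec_def intro!: sum.neutral)
  then have "R (\<lambda>x. c l * basis_vec l x + 1 * ?v x) = (\<lambda>x. c l * R (basis_vec l) x + 1 * R ?v x)"
    by (rule GL_group_alg_linear[OF R])
  then show ?case
    using insert by simp
qed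

lemma group_alg_eq_sum:
  assumes "finite (carrier A)" "v \<in> group_alg A"
  shows "v = (\<lambda>x. \<Sum>l\<in>carrier A. v l * basis_vec l x)"
  using assms by (auto simp: group_alg_def basis_vec_def if_distrib cong: if_cong)

context discriminant_form
begin

lemma weil_modular_forms_T:
  assumes f: "f \<in> weil_modular_forms A Q k" and \<tau>: "\<tau> \<in> \<H>"
  shows "f (\<tau> + 1) x = exp2pi_mod (Q x) * f \<tau> x"
proof -
  obtain \<rho> where \<rho>: "weil_representation A Q \<rho>" and ga: "f \<tau> \<in> group_alg A"
    and tr: "\<forall>(M, \<phi>)\<in>carrier Mp2Z. \<forall>\<tau>\<in>\<H>. f (moeb M \<tau>) = (\<lambda>\<mu>. (\<phi> \<tau> powi \<lfloor>2 * k\<rfloor>) * \<rho> (M, \<phi>) (f \<tau>) \<mu>)"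
    using f \<tau> by (auto simp: weil_modular_forms_def)
  have R: "\<rho> mp_T \<in> carrier (GL_group_alg A)"
    using \<rho> mp_T_carrier by (auto simp: weil_representation_def hom_def)
  have "f (moeb (fst mp_T) \<tau>) = (\<lambda>\<mu>. (snd mp_T \<tau> powi \<lfloor>2 * k\<rfloor>) * \<rho> mp_T (f \<tau>) \<mu>)"
    using tr mp_T_carrier \<tau> by (auto simp: split_def)
  \<comment> \<open>The second component of \<open>mp_T\<close> is 1 on the upper half plane, so the
    automorphy factor is 1 in every weight.\<close>
  then have "f (\<tau> + 1) = \<rho> mp_T (f \<tau>)"
    using \<tau> by (simp add: mp_T_def moeb_def)
  also have "\<dots> = \<rho> mp_T (\<lambda>x. \<Sum>l\<in>carrier A. f \<tau> l * basis_vec l x)"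
    using group_alg_eq_sum[OF finite_carrier ga] by simp
  also have "\<dots> = (\<lambda>x. \<Sum>l\<in>carrier A. f \<tau> l * \<rho> mp_T (basis_vec l) x)"
    by (rule GL_group_alg_sum[OF R finite_carrier]) simp
  also have "\<dots> = (\<lambda>x. \<Sum>l\<in>carrier A. f \<tau> l * (exp2pi_mod (Q l) * basis_vec l x))"
    using \<rho> by (simp add: weil_representation_def)
  finally show ?thesis
    using finite_carrier ga by (auto simp: basis_vec_def if_distrib group_alg_def cong: if_cong)
qed

lemma weil_modular_forms_T_pow:
  assumes f: "f \<in> weil_modular_forms A Q k" and \<tau>: "\<tau> \<in> \<H>"
  shows "f (\<tau> + of_nat n) x = exp2pi_mod (Q x) ^ n * f \<tau> x"
proof (induction n)
  case (Suc n)
  have "\<tau> + of_nat n \<in> \<H>"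
    using \<tau> by (simp add: upper_half_plane_def)
  then show ?case
    using weil_modular_forms_T[OF f, of "\<tau> + of_nat n" x] Suc by (simp add: add_ac)
qed simp

text \<open>The constant c collects the automorphy factor at \<tau> and the scalar in the action of
  S. It may depend on \<tau>, but it is the same for all x and \<mu>.\<close>

lemma weil_modular_forms_S:
  assumes f: "f \<in> weil_modular_forms A Q k" and \<tau>: "\<tau> \<in> \<H>"
  obtains c where "\<And>x. x \<in> carrier A \<Longrightarrow>
    f (- 1 / \<tau>) x = (\<Sum>\<mu>\<in>carrier A. c * f \<tau> \<mu> * exp2pi_mod (- bilin A Q \<mu> x))"
proof -
  obtain \<rho> where \<rho>: "weil_representation A Q \<rho>" and ga: "f \<tau> \<in> group_alg A"
    and tr: "\<forall>(M, \<phi>)\<in>carrier Mp2Z. \<forall>\<tau>\<in>\<H>. f (moeb M \<tau>) = (\<lambda>\<mu>. (\<phi> \<tau> powi \<lfloor>2 * k\<rfloor>) * \<rho> (M, \<phi>) (f \<tau>) \<mu>)"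
    using f \<tau> by (auto simp: weil_modular_forms_def)
  define a where "a = snd mp_S \<tau> powi \<lfloor>2 * k\<rfloor>"
  define b where "b = exp2pi (- of_int (sig A Q) / 8) / of_real (sqrt (real (card (carrier A))))"
  have R: "\<rho> mp_S \<in> carrier (GL_group_alg A)"
    using \<rho> mp_S_carrier by (auto simp: weil_representation_def hom_def)
  have "f (moeb (fst mp_S) \<tau>) = (\<lambda>\<mu>. a * \<rho> mp_S (f \<tau>) \<mu>)"
    using tr mp_S_carrier \<tau> by (auto simp: split_def a_def)
  moreover have "moeb (fst mp_S) \<tau> = - 1 / \<tau>"
    by (simp add: mp_S_def moeb_def)
  moreover have "\<rho> mp_S (f \<tau>) = \<rho> mp_S (\<lambda>x. \<Sum>l\<in>carrier A. f \<tau> l * basis_vec l x)"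
    using group_alg_eq_sum[OF finite_carrier ga] by simp
  moreover have "\<dots> = (\<lambda>x. \<Sum>l\<in>carrier A. f \<tau> l * \<rho> mp_S (basis_vec l) x)"
    by (rule GL_group_alg_sum[OF R finite_carrier]) simp
  moreover have "\<dots> = (\<lambda>x. \<Sum>l\<in>carrier A. f \<tau> l * (b * (\<Sum>\<mu>\<in>carrier A. exp2pi_mod (- bilin A Q l \<mu>) * basis_vec \<mu> x)))"
    using \<rho> by (simp add: weil_representation_def b_def)
  ultimately have "f (- 1 / \<tau>) x = (\<Sum>\<mu>\<in>carrier A. (a * b) * f \<tau> \<mu> * exp2pi_mod (- bilin A Q \<mu> x))"
    if "x \<in> carrier A" for x
    using that finite_carrier
    by (simp add: basis_vec_def if_distrib sum_distrib_left mult_ac cong: if_cong)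
  then show thesis
    by (rule that)
qed

end

section \<open>Combining the S- and T-transformations\<close>

theorem theorem3p6:
  fixes A :: "('a, 'm) monoid_scheme" and Q :: "'a \<Rightarrow> rat_mod_int"
    and k :: rat and m :: nat and p :: "nat \<Rightarrow> nat" and H :: "nat \<Rightarrow> 'a set"
    and f :: "complex \<Rightarrow> 'a \<Rightarrow> complex"
  assumes "discriminant_form A Q"
    and "2 * k \<in> \<int>"
    and "\<And>i. i \<in> {1..m} \<Longrightarrow> isotropic A Q (H i)"
    and "\<And>i. i \<in> {1..m} \<Longrightarrow> card (H i) = p i \<and> prime (p i)"
    and "\<And>i j. i \<in> {1..m} \<Longrightarrow> j \<in> {1..m} \<Longrightarrow> i \<noteq> j \<Longrightarrow> p i \<noteq> p j"
    and "f \<in> weil_modular_forms A Q k"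
    and "supported_on A f (\<Union>i\<in>{1..m}. perp A Q (H i))"
  shows "\<forall>\<tau>\<in>\<H>. f \<tau> = (\<lambda>\<mu>. \<Sum>S \<in> {S. S \<noteq> {} \<and> S \<subseteq> {1..m}}.
    (-1) ^ (card S + 1) * (1 / of_nat (card (subgroup_sum A H S))) *
      up A Q (subgroup_sum A H S) (down A Q (subgroup_sum A H S) f) \<tau> \<mu>)"
proof (intro ballI ext)
  fix \<tau> x assume \<tau>: "\<tau> \<in> \<H>"
  interpret discriminant_form A Q
    by fact
  interpret isotropic_family A Q H p "{1..m}"
    using assms(3-5) by unfold_locales auto
  show "f \<tau> x = (\<Sum>S \<in> {S. S \<noteq> {} \<and> S \<subseteq> {1..m}}. (-1) ^ (card S + 1) * (1 / of_nat (card (HS S))) *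
      up A Q (HS S) (down A Q (HS S) f) \<tau> x)"
  proof (cases "x \<in> carrier A")
    case False
    then have "f \<tau> x = 0"
      using assms(6) \<tau> by (auto simp: weil_modular_forms_def group_alg_def)
    moreover have "x \<notin> perp A Q (HS S)" for S
      using False by (simp add: perp_def)
    ultimately show ?thesis
      by (simp add: up_down[OF isotropic_HS])
  next
    case True
    have zero: "(\<Sum>S\<in>Pow {1..m}. weight S * (\<Sum>y\<in>HS S. f \<sigma> (y \<otimes>\<^bsub>A\<^esub> x))) = 0" if \<sigma>: "\<sigma> \<in> \<H>" for \<sigma>
    proof -
      have S: "- 1 / \<sigma> \<in> \<H>"
        using \<sigma> by (simp add: upper_half_plane_def Im_divide power2_eq_square sum_squares_gt_zero_iff complex_eq_iff divide_neg_pos)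
      \<comment> \<open>Since -1/(-1/\<sigma>) = \<sigma>, applying the transformation at
        -1/\<sigma> expresses f \<sigma> through the values at -1/\<sigma>, where the support
        condition limits the characters that occur.\<close>
      obtain c where c: "\<And>x. x \<in> carrier A \<Longrightarrow>
          f \<sigma> x = (\<Sum>\<mu>\<in>carrier A. c * f (- 1 / \<sigma>) \<mu> * exp2pi_mod (- bilin A Q \<mu> x))"
        using weil_modular_forms_S[OF assms(6) S] by auto
      show ?thesis
        using assms(7) S c True
        by (intro sum_weight_fourier_eq_zero[where u = "\<lambda>\<mu>. c * f (- 1 / \<sigma>) \<mu>"]) (auto simp: supported_on_def)
    qed
    have "(\<Sum>S\<in>Pow (perp_index x). weight S * (\<Sum>y\<in>HS S. f \<tau> (y \<otimes>\<^bsub>A\<^esub> x))) = 0"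
    proof (rule sum_weight_perp_index_eq_zero[OF _ True])
      \<comment> \<open>The vanishing holds at every point of the upper half plane; at \<tau> + n,
        each component acquires the n-th power of its T-eigenvalue, giving the power sums that the
        filter needs.\<close>
      fix n :: nat
      have "\<tau> + of_nat n \<in> \<H>"
        using \<tau> by (simp add: upper_half_plane_def)
      then show "(\<Sum>S\<in>Pow {1..m}. weight S *
          (\<Sum>y\<in>HS S. exp2pi_mod (Q (y \<otimes>\<^bsub>A\<^esub> x)) ^ n * f \<tau> (y \<otimes>\<^bsub>A\<^esub> x))) = 0"
        using zero[of "\<tau> + of_nat n"] by (simp add: weil_modular_forms_T_pow[OF assms(6) \<tau>])
    qed
    then show ?thesis
      using sum_up_down_eq True by simp
  qed
qed

end
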